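(* Let $\mathbb{P}^{\tilde a,\tilde b,\tilde c}_{a,b,c}$ be a generic three-jug puzzle, and let $G_P$ be the directed graph associated with the ordered quadruple $P=(a,b,c,\tilde a+\tilde b+\tilde c)$. Then the puzzle $\mathbb{P}^{\tilde a,\tilde b,\tilde c}_{a,b,c}$ has a solution if and only if there exists a directed path in $G_P$ from the vertex $(\tilde b,\tilde c)$ to the vertex $\left(\frac{\tilde a+\tilde b+\tilde c}{2},0\right)$.
   Context: **Generic three-jug puzzle.** An instance $\mathbb{P}^{\tilde a,\tilde b,\tilde c}_{a,b,c}$ consists of three jugs $A,B,C$ with capacities $a,b,c$ gallons, where $a>b>c$, currently containing $\tilde a,\tilde b,\tilde c$ gallons of wine respectively (so $\tilde a\le a$, $\tilde b\le b$, $\tilde c\le c$). All the numbers $a,b,c,\tilde a,\tilde b,\tilde c$ are positive integers. Put $d=\tilde a+\tilde b+\tilde c$; it is assumed that for some positive integer $k$, $d=2k$ and $b\ge k$. The puzzle asks whether the $d$ gallons can be divided into two halves only by a series of measurable pours. **Distributions.** The distribution $(i,j)$ is the one in which jug $B$ contains $i$ gallons, jug $C$ contains $j$ gallons, and jug $A$ contains $d-i-j$ gallons, where $i,j$ are integers with $0\le i\le b$, $0\le j\le c$ and $0\le d-i-j\le a$. The initial distribution is $(\tilde b,\tilde c)$. **Measurable pour.** For two different jugs $X,Y\in\{A,B,C\}$, the measurable pour $X\downarrow Y$ consists of pouring wine from $X$ to $Y$, stopping when $X$ becomes empty or $Y$ reaches its capacity. That is, the amount transferred is the minimum of the current content of $X$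 and the remaining free space in $Y$, and the third jug is unchanged. **Solution.** The puzzle has a solution if the distribution $\left(\frac d2,0\right)$ (jugs $A$ and $B$ each contain $d/2$ gallons and $C$ is empty) can be reached from the initial distribution $(\tilde b,\tilde c)$ by a finite sequence of measurable pours. **The directed graph.** For an ordered quadruple $Q=(a,b,c,d)$ of positive integers with $a>b>c$ and such that, for some positive integer $k$, $d=2k$ and $b\ge k$, the directed graph $G_Q$ has vertex set $$V(G_Q)=\{(i,j)\in\mathbb{Z}^2 : 0\le i\le b,\ 0\le j\le c\}.$$ There is a directed edge from a vertex $(i,j)$ to another (i.e. different) vertex $(i',j')$ if and only if $0\le d-i-j\le a$, $0\le d-i'-j'\le a$, and at least one of the following holds: 1. $j'=j$ and $i'\in\{0,\,b,\,d-j,\,d-a-j\}$; 2. $i'=i$ and $j'\in\{0,\,c,\,d-i,\,d-a-i\}$; 3. $i+j=i'+j'$ and ($i'\in\{0,b\}$ or $j'\in\{0,c\}$). *)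

theory Defs
  imports "Graph_Theory.Pair_Digraph"
begin

datatype jug = JugA | JugB | JugC

definition generic_three_jug_puzzle ::
  "int \<Rightarrow> int \<Rightarrow> int \<Rightarrow> int \<Rightarrow> int \<Rightarrow> int \<Rightarrow> bool" where
  "generic_three_jug_puzzle a b c a0 b0 c0 \<longleftrightarrow>
     0 < c \<and> c < b \<and> b < a \<and>
     0 < a0 \<and> a0 \<le> a \<and> 0 < b0 \<and> b0 \<le> b \<and> 0 < c0 \<and> c0 \<le> c \<and>
     (\<exists>k>0. a0 + b0 + c0 = 2 * k \<and> k \<le> b)"

fun capacity :: "int \<Rightarrow> int \<Rightarrow> int \<Rightarrow> jug \<Rightarrow> int" where
  "capacity a b c JugA = a"
| "capacity a b c JugB = b"
| "capacity a b c JugC = c"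

text \<open>A distribution records only the contents of the jugs B and C; jug A contains the
  rest of the total amount \<open>d\<close>.\<close>

fun contents :: "int \<Rightarrow> int \<times> int \<Rightarrow> jug \<Rightarrow> int" where
  "contents d (i, j) JugA = d - i - j"
| "contents d (i, j) JugB = i"
| "contents d (i, j) JugC = j"

definition distribution :: "int \<Rightarrow> int \<Rightarrow> int \<Rightarrow> int \<Rightarrow> int \<times> int \<Rightarrow> bool" where
  "distribution a b c d p \<longleftrightarrow>
     (\<forall>X. 0 \<le> contents d p X \<and> contents d p X \<le> capacity a b c X)"

definition pour :: "(jug \<Rightarrow> int) \<Rightarrow> jug \<Rightarrow> jug \<Rightarrow> (jug \<Rightarrow> int) \<Rightarrow> jug \<Rightarrow> int" where
  "pour cap X Y s =
     (let m = min (s X) (cap Y - s Y) in s(X := s X - m, Y := s Y + m))"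

definition measurable_pour ::
  "int \<Rightarrow> int \<Rightarrow> int \<Rightarrow> int \<Rightarrow> int \<times> int \<Rightarrow> int \<times> int \<Rightarrow> bool" where
  "measurable_pour a b c d p q \<longleftrightarrow>
     distribution a b c d p \<and> distribution a b c d q \<and>
     (\<exists>X Y. X \<noteq> Y \<and> contents d q = pour (capacity a b c) X Y (contents d p))"

text \<open>The division by 2 is exact for the puzzles considered, where the total amount is even.\<close>

definition has_solution ::
  "int \<Rightarrow> int \<Rightarrow> int \<Rightarrow> int \<Rightarrow> int \<Rightarrow> int \<Rightarrow> bool" where
  "has_solution a b c a0 b0 c0 \<longleftrightarrow>
     (let d = a0 + b0 + c0 in (measurable_pour a b c d)\<^sup>*\<^sup>* (b0, c0) (d div 2, 0))"

definition jug_vertices :: "int \<Rightarrow> int \<Rightarrow> (int \<times> int) set" where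
  "jug_vertices b c = {(i, j). 0 \<le> i \<and> i \<le> b \<and> 0 \<le> j \<and> j \<le> c}"

definition jug_edge ::
  "int \<Rightarrow> int \<Rightarrow> int \<Rightarrow> int \<Rightarrow> int \<times> int \<Rightarrow> int \<times> int \<Rightarrow> bool" where
  "jug_edge a b c d = (\<lambda>(i, j) (i', j').
     (i, j) \<noteq> (i', j') \<and>
     0 \<le> d - i - j \<and> d - i - j \<le> a \<and> 0 \<le> d - i' - j' \<and> d - i' - j' \<le> a \<and>
     (j' = j \<and> i' \<in> {0, b, d - j, d - a - j} \<or>
      i' = i \<and> j' \<in> {0, c, d - i, d - a - i} \<or>
      i + j = i' + j' \<and> (i' \<in> {0, b} \<or> j' \<in> {0, c})))"

definition jug_graph :: "int \<Rightarrow> int \<Rightarrow> int \<Rightarrow> int \<Rightarrow> (int \<times> int) pair_pre_digraph" where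
  "jug_graph a b c d =
     \<lparr>pverts = jug_vertices b c,
      parcs = {(v, w). v \<in> jug_vertices b c \<and> w \<in> jug_vertices b c \<and> jug_edge a b c d v w}\<rparr>"

end

theory Submission
  imports Defs
begin

text \<open>
  Both sides are reachability statements, so it suffices to compare single steps: an arc of
  the graph should be exactly a measurable pour that changes the distribution. Pours that
  change nothing are invisible to reachability, and by \<open>reachable_apath\<close> reachability
  in the graph is the same as the existence of a directed path with distinct vertices.

  The comparison rests on \<open>pour_iff_empty_or_full\<close>. A pour \<open>X \<down> Y\<close> is defined by
  an amount, the minimum of two quantities, whereas an arc only mentions its target
  distribution. The two descriptions agree because, among distributions that
  leave the third jug alone, the outcome of \<open>X \<down> Y\<close> is the only one in which \<open>X\<close> is empty
  or \<open>Y\<close> is full. Hence such a distribution results from a pour between two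
  given jugs, in one direction or the other, if and only if one of the two is empty or full
  in it. Clause by clause this is
  the definition of the arcs: the values \<open>0, b, d - j, d - a - j\<close> for \<open>i'\<close> make \<open>B\<close> empty,
  \<open>B\<close> full, \<open>A\<close> empty and \<open>A\<close> full, respectively, when \<open>C\<close> is not involved, and similarly
  for the other two pairs of jugs.
\<close>

text \<open>
  The amount that leaves \<open>X\<close> equals the amount that \<open>Y\<close> gains. It is at most \<open>s X\<close>, since
  \<open>t X\<close> is nonnegative, with equality if and only if \<open>X\<close> ends up empty; and it is at most
  \<open>cap Y - s Y\<close>, with equality if and only if \<open>Y\<close> ends up full. So it equals the
  minimum of these bounds if and only if one of the two happens. If \<open>X\<close> is empty or \<open>Y\<close> is
  full in \<open>t\<close>, then the wine, if any moves, moves from \<open>X\<close> to \<open>Y\<close>.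
\<close>

lemma pour_iff_empty_or_full:
  fixes s t :: "jug \<Rightarrow> int"
  assumes "X \<noteq> Y"
    and third: "\<And>Z. Z \<noteq> X \<Longrightarrow> Z \<noteq> Y \<Longrightarrow> t Z = s Z"
    and total: "t X + t Y = s X + s Y"
    and "0 \<le> s X" "s Y \<le> cap Y" "0 \<le> t X" "t Y \<le> cap Y"
  shows "t = pour cap X Y s \<longleftrightarrow> t X = 0 \<or> t Y = cap Y"
proof -
  have "t = pour cap X Y s \<longleftrightarrow> t X = pour cap X Y s X \<and> t Y = pour cap X Y s Y"
    using \<open>X \<noteq> Y\<close> third by (auto simp: fun_eq_iff pour_def Let_def)
  also have "\<dots> \<longleftrightarrow> t Y - s Y = min (s X) (cap Y - s Y)"
    using \<open>X \<noteq> Y\<close> total by (auto simp: pour_def Let_def)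
  also have "\<dots> \<longleftrightarrow> t X = 0 \<or> t Y = cap Y"
    using assms(4-) total by (auto simp: min_def)
  finally show ?thesis .
qed

lemma pour_third_jug:
  assumes "Z \<noteq> X" "Z \<noteq> Y"
  shows "pour cap X Y s Z = s Z"
  using assms by (simp add: pour_def Let_def)

lemma forall_jug: "(\<forall>Z. P Z) \<longleftrightarrow> P JugA \<and> P JugB \<and> P JugC"
  by (metis jug.exhaust)

lemma exists_jug: "(\<exists>Z. P Z) \<longleftrightarrow> P JugA \<or> P JugB \<or> P JugC"
  by (metis jug.exhaust)

text \<open>
  The contents of the three jugs always sum to \<open>d\<close>, so an unchanged third jug supplies the
  conservation law that \<open>pour_iff_empty_or_full\<close> requires.
\<close>

lemma contents_pair_total:
  assumes "X \<noteq> Y"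
    and "\<forall>Z. Z \<noteq> X \<longrightarrow> Z \<noteq> Y \<longrightarrow> contents d q Z = contents d p Z"
  shows "contents d q X + contents d q Y = contents d p X + contents d p Y"
  using assms by (cases p; cases q; cases X; cases Y) (auto simp: forall_jug)

lemma measurable_pour_iff:
  "measurable_pour a b c d p q \<longleftrightarrow>
     distribution a b c d p \<and> distribution a b c d q \<and>
     (\<exists>X Y. X \<noteq> Y \<and> (\<forall>Z. Z \<noteq> X \<longrightarrow> Z \<noteq> Y \<longrightarrow> contents d q Z = contents d p Z) \<and>
       (contents d q X = 0 \<or> contents d q Y = capacity a b c Y))"
proof -
  have "contents d q = pour (capacity a b c) X Y (contents d p) \<longleftrightarrow>
      (\<forall>Z. Z \<noteq> X \<longrightarrow> Z \<noteq> Y \<longrightarrow> contents d q Z = contents d p Z) \<and>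
      (contents d q X = 0 \<or> contents d q Y = capacity a b c Y)"
    (is "?pour \<longleftrightarrow> ?third \<and> ?extreme")
    if "X \<noteq> Y" "distribution a b c d p" "distribution a b c d q" for X Y
  proof -
    have "?pour \<longrightarrow> ?third"
      by (simp add: pour_third_jug)
    moreover have "?pour \<longleftrightarrow> ?extreme" if ?third
      using that \<open>X \<noteq> Y\<close> \<open>distribution a b c d p\<close> \<open>distribution a b c d q\<close>
        contents_pair_total[OF \<open>X \<noteq> Y\<close> that]
      by (intro pour_iff_empty_or_full) (auto simp: distribution_def)
    ultimately show ?thesis by blast
  qed
  then show ?thesis
    unfolding measurable_pour_def by blast
qed

text \<open>
  The ordered pairs of jugs are grouped by the jug that stays untouched. The two orders of the
  same pair merge: either jug of the pair may be the empty one or the full one. This yields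
  the three clauses in the definition of the arcs.
\<close>

lemma exists_jug_pair:
  "(\<exists>X Y. X \<noteq> Y \<and> (\<forall>Z. Z \<noteq> X \<longrightarrow> Z \<noteq> Y \<longrightarrow> fixed Z) \<and> (E X \<or> F Y)) \<longleftrightarrow>
     fixed JugC \<and> (E JugA \<or> F JugA \<or> E JugB \<or> F JugB) \<or>
     fixed JugB \<and> (E JugA \<or> F JugA \<or> E JugC \<or> F JugC) \<or>
     fixed JugA \<and> (E JugB \<or> F JugB \<or> E JugC \<or> F JugC)"
  by (simp add: exists_jug forall_jug) blast

text \<open>
  After the bounds on both ends of an arc are recognised as the conditions for a distribution,
  each clause for arcs only has to be rewritten as a condition on the new contents of the
  two jugs involved. The first clause concerns \<open>A\<close> and \<open>B\<close>, the second \<open>A\<close> and \<open>C\<close>, the third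
  \<open>B\<close> and \<open>C\<close>.
\<close>

lemma jug_arc_iff_measurable_pour:
  "(p, q) \<in> parcs (jug_graph a b c d) \<longleftrightarrow> measurable_pour a b c d p q \<and> p \<noteq> q"
proof -
  obtain i j i' j' where pq: "p = (i, j)" "q = (i', j')"
    by (cases p, cases q)
  have dist: "distribution a b c d (x, y) \<longleftrightarrow>
      (x, y) \<in> jug_vertices b c \<and> 0 \<le> d - x - y \<and> d - x - y \<le> a" for x y
    by (auto simp: distribution_def jug_vertices_def forall_jug)
  have AB: "j' = j \<and> i' \<in> {0, b, d - j, d - a - j} \<longleftrightarrow>
      j' = j \<and> (d - i' - j' = 0 \<or> d - i' - j' = a \<or> i' = 0 \<or> i' = b)"
    by auto
  have AC: "i' = i \<and> j' \<in> {0, c, d - i, d - a - i} \<longleftrightarrow>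
      i' = i \<and> (d - i' - j' = 0 \<or> d - i' - j' = a \<or> j' = 0 \<or> j' = c)"
    by auto
  have BC: "i + j = i' + j' \<and> (i' \<in> {0, b} \<or> j' \<in> {0, c}) \<longleftrightarrow>
      d - i' - j' = d - i - j \<and> (i' = 0 \<or> i' = b \<or> j' = 0 \<or> j' = c)"
    by auto
  have "(p, q) \<in> parcs (jug_graph a b c d) \<longleftrightarrow>
      p \<noteq> q \<and> distribution a b c d p \<and> distribution a b c d q \<and>
      (j' = j \<and> i' \<in> {0, b, d - j, d - a - j} \<or>
       i' = i \<and> j' \<in> {0, c, d - i, d - a - i} \<or>
       i + j = i' + j' \<and> (i' \<in> {0, b} \<or> j' \<in> {0, c}))"
    unfolding pq dist jug_graph_def jug_edge_def pair_pre_digraph.simps mem_Collect_eq prod.case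
    by (rule iffI) (elim conjE, intro conjI, assumption+)+
  also have "\<dots> \<longleftrightarrow> measurable_pour a b c d p q \<and> p \<noteq> q"
    unfolding AB AC BC measurable_pour_iff exists_jug_pair pq contents.simps capacity.simps
    by (rule iffI) (elim conjE, intro conjI, assumption+)+
  finally show ?thesis .
qed

lemma pair_wf_digraph_jug_graph: "pair_wf_digraph (jug_graph a b c d)"
  by unfold_locales (auto simp: jug_graph_def)

theorem corollary3p2:
  fixes a b c a0 b0 c0 :: int
  assumes "generic_three_jug_puzzle a b c a0 b0 c0"
  shows "has_solution a b c a0 b0 c0 \<longleftrightarrow>
    (\<exists>p. pre_digraph.apath (with_proj (jug_graph a b c (a0 + b0 + c0)))
           (b0, c0) p ((a0 + b0 + c0) div 2, 0))"
proof -
  define d where "d = a0 + b0 + c0"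
  define G where "G = jug_graph a b c d"
  interpret G: pair_wf_digraph G
    unfolding G_def by (rule pair_wf_digraph_jug_graph)
  \<comment> \<open>Needed for the empty path, which is a path in the graph only at one of its vertices.\<close>
  have start: "(b0, c0) \<in> pverts G"
    using assms by (simp add: G_def jug_graph_def jug_vertices_def generic_three_jug_puzzle_def)
  have "has_solution a b c a0 b0 c0 \<longleftrightarrow>
      (measurable_pour a b c d)\<^sup>*\<^sup>* (b0, c0) (d div 2, 0)"
    by (simp add: has_solution_def d_def Let_def)
  also have "\<dots> \<longleftrightarrow> ((b0, c0), (d div 2, 0)) \<in> (parcs G)\<^sup>*"
  proof -
    have "inf (measurable_pour a b c d) (\<noteq>) = (\<lambda>p q. (p, q) \<in> parcs G)"
      by (simp add: fun_eq_iff G_def jug_arc_iff_measurable_pour)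
    then have "(measurable_pour a b c d)\<^sup>*\<^sup>* = (\<lambda>p q. (p, q) \<in> (parcs G)\<^sup>*)"
      using rtranclp_r_diff_Id[of "measurable_pour a b c d"]
      by (simp only: Transitive_Closure.rtranclp_rtrancl_eq)
    then show ?thesis
      by simp
  qed
  also have "\<dots> \<longleftrightarrow> (b0, c0) \<rightarrow>\<^sup>*\<^bsub>with_proj G\<^esub> (d div 2, 0)"
    using start by (simp add: G.reachable_conv')
  also have "\<dots> \<longleftrightarrow> (\<exists>p. pre_digraph.apath (with_proj G) (b0, c0) p (d div 2, 0))"
    by (rule G.reachable_apath)
  finally show ?thesis
    by (simp add: G_def d_def)
qed

end
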